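(* Let $\mathbb{E}:\mathbb{M}_n\to\mathbb{M}_n$ be a positive linear map and assume that $\mathbb{E}$ is unital and trace-preserving. Then $\|\mathbb{E}(Z)\|_!\ge\|Z\|_!$ holds for all $Z\in\mathbb{M}_n^+$ and all symmetric anti-norms $\|\cdot\|_!$ on $\mathbb{M}_n^+$.
   Context: $\mathbb{M}_n$ is the algebra of $n\times n$ complex matrices and $\mathbb{M}_n^+$ the set of its positive semidefinite matrices. A symmetric anti-norm on $\mathbb{M}_n^+$ is a non-negative continuous functional $\|\cdot\|_!$ on $\mathbb{M}_n^+$ such that (1) $\|\lambda A\|_!=\lambda\|A\|_!$ for all $A\in\mathbb{M}_n^+$ and reals $\lambda\ge0$; (2) $\|A\|_!=\|UAU^*\|_!$ for all $A\in\mathbb{M}_n^+$ and unitaries $U$; (3) $\|A+B\|_!\ge\|A\|_!+\|B\|_!$ for all $A,B\in\mathbb{M}_n^+$. *)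

theory Defs
  imports "HOL-Analysis.Analysis"
begin

definition cadjoint :: "complex^'n^'m \<Rightarrow> complex^'m^'n" where
  "cadjoint A = (\<chi> i j. cnj (A $ j $ i))"

definition unitary_matrix :: "complex^'n^'n \<Rightarrow> bool" where
  "unitary_matrix U \<longleftrightarrow> U ** cadjoint U = mat 1 \<and> cadjoint U ** U = mat 1"

(* For Hermitian A the sum x* A x is real, so taking Re loses nothing. *)
definition psd :: "complex^'n^'n \<Rightarrow> bool" where
  "psd A \<longleftrightarrow> cadjoint A = A \<and>
     (\<forall>x. 0 \<le> Re (\<Sum>i\<in>UNIV. cnj (x $ i) * (A *v x) $ i))"

(* The library's *s on complex^'n^'n would take scalars of type complex^'n and its *\<^sub>R
   only real ones, so the complex vector space structure on matrices is given explicitly. *)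
definition cscale_matrix :: "complex \<Rightarrow> complex^'n^'m \<Rightarrow> complex^'n^'m" where
  "cscale_matrix c A = (\<chi> i j. c * A $ i $ j)"

lemma vector_space_cscale_matrix: "vector_space cscale_matrix"
  by unfold_locales (simp_all add: cscale_matrix_def vec_eq_iff algebra_simps)

definition positive_linear_map :: "(complex^'n^'n \<Rightarrow> complex^'n^'n) \<Rightarrow> bool" where
  "positive_linear_map E \<longleftrightarrow>
     Vector_Spaces.linear cscale_matrix cscale_matrix E \<and> (\<forall>A. psd A \<longrightarrow> psd (E A))"

definition unital_map :: "(complex^'n^'n \<Rightarrow> complex^'n^'n) \<Rightarrow> bool" where
  "unital_map E \<longleftrightarrow> E (mat 1) = mat 1"

definition trace_preserving :: "(complex^'n^'n \<Rightarrow> complex^'n^'n) \<Rightarrow> bool" where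
  "trace_preserving E \<longleftrightarrow> (\<forall>A. trace (E A) = trace A)"

(* A functional on the positive semidefinite cone is a total function here; its values
   outside the cone are unconstrained. *)
definition symmetric_anti_norm :: "(complex^'n^'n \<Rightarrow> real) \<Rightarrow> bool" where
  "symmetric_anti_norm N \<longleftrightarrow>
     (\<forall>A. psd A \<longrightarrow> 0 \<le> N A) \<and>
     continuous_on {A. psd A} N \<and>
     (\<forall>A c. psd A \<longrightarrow> 0 \<le> c \<longrightarrow> N (c *\<^sub>R A) = c * N A) \<and>
     (\<forall>A U. psd A \<longrightarrow> unitary_matrix U \<longrightarrow> N A = N (U ** A ** cadjoint U)) \<and>
     (\<forall>A B. psd A \<longrightarrow> psd B \<longrightarrow> N (A + B) \<ge> N A + N B)"

end

theory Submission
  imports Defs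
begin

text \<open>
  The idea is that \<open>E Z\<close> is an average of unitary conjugates of \<open>Z\<close>, that is, it lies in the
  convex hull of the unitary orbit of \<open>Z\<close> (\<open>doubly_stochastic_map_in_hull_orbit\<close>).
  Superadditivity and homogeneity make an anti-norm concave, and it is constant on the orbit, so
  on the hull it is at least its value at \<open>Z\<close> (\<open>anti_norm_ge_on_hull_orbit\<close>).

  For the membership, the hull is compact because the unitary group is.  If \<open>E Z\<close> were outside,
  a hyperplane would separate it from the hull, and its normal can be taken to be a Hermitian
  matrix \<open>H\<close>.  So it suffices to find, for every Hermitian \<open>H\<close>, one orbit point \<open>X\<close> of \<open>Z\<close> with
  \<open>H \<bullet> E Z \<le> H \<bullet> X\<close> (\<open>inner_doubly_stochastic_map_le\<close>).  Diagonalise \<open>H\<close> and \<open>Z\<close> with eigenvalues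
  \<open>h\<close> and \<open>z\<close> listed in the same order.  In these two bases \<open>E\<close> acts on diagonals by a doubly
  stochastic matrix \<open>D\<close>, so the left side is the sum of the \<open>D i j * (h i * z j)\<close>.  Since \<open>h\<close> and \<open>z\<close>
  are equally ordered, this is at most the sum of the \<open>h i * z i\<close>
  (\<open>doubly_stochastic_rearrangement\<close>), which the orbit point with the eigenvectors of \<open>H\<close> and the
  eigenvalues of \<open>Z\<close> attains.

  Two steps avoid heavier theory.  The rearrangement inequality is proved by linear programming
  duality instead of Birkhoff's theorem (\<open>dual_potentials\<close>), and the spectral theorem comes from
  maximising a weighted sum of diagonal entries over the unitary group
  (\<open>spectral_theorem_sorted\<close>), which yields the ordering of the eigenvalues as well.
\<close>

section \<open>Adjoints, unitary conjugation and positivity\<close>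

lemma cadjoint_cadjoint [simp]: "cadjoint (cadjoint A) = A"
  by (simp add: cadjoint_def vec_eq_iff)

lemma cadjoint_mult: "cadjoint (A ** B) = cadjoint B ** cadjoint A"
  by (simp add: cadjoint_def matrix_matrix_mult_def vec_eq_iff mult.commute)

lemma cadjoint_mat_1 [simp]: "cadjoint (mat 1) = mat 1"
  by (auto simp: cadjoint_def mat_def vec_eq_iff)

lemma cadjoint_add: "cadjoint (A + B) = cadjoint A + cadjoint B"
  by (simp add: cadjoint_def vec_eq_iff)

lemma cadjoint_minus: "cadjoint (- A) = - cadjoint A"
  by (simp add: cadjoint_def vec_eq_iff)

lemma cadjoint_scaleR: "cadjoint (r *\<^sub>R A) = r *\<^sub>R cadjoint A"
  by (simp add: cadjoint_def vec_eq_iff)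

lemma unitary_matrix_iff:
  fixes U :: "complex^'n^'n"
  shows "unitary_matrix U \<longleftrightarrow> U ** cadjoint U = mat 1"
  unfolding unitary_matrix_def using matrix_left_right_inverse by blast

lemma unitary_matrix_cadjoint: "unitary_matrix U \<Longrightarrow> unitary_matrix (cadjoint U)"
  by (simp add: unitary_matrix_def)

lemma unitary_matrix_mult:
  "unitary_matrix U \<Longrightarrow> unitary_matrix V \<Longrightarrow> unitary_matrix (U ** V)"
  unfolding unitary_matrix_iff cadjoint_mult
  by (metis matrix_mul_assoc matrix_mul_rid)

lemma unitary_conj_cancel:
  assumes "unitary_matrix U"
  shows "cadjoint U ** (U ** A ** cadjoint U) ** U = A"
proof -
  have "cadjoint U ** (U ** A ** cadjoint U) ** U
      = (cadjoint U ** U) ** A ** (cadjoint U ** U)"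
    by (simp add: matrix_mul_assoc)
  then show ?thesis
    using assms by (simp add: unitary_matrix_def)
qed

lemma linear_conj: "linear (\<lambda>X::complex^'n^'n. A ** X ** B)"
proof (rule linearI)
  show "A ** (X + Y) ** B = A ** X ** B + A ** Y ** B" for X Y :: "complex^'n^'n"
    by (simp add: vec_eq_iff matrix_matrix_mult_def sum.distrib distrib_left distrib_right)
  show "A ** (r *\<^sub>R X) ** B = r *\<^sub>R (A ** X ** B)" for r and X :: "complex^'n^'n"
    by (simp add: vec_eq_iff matrix_matrix_mult_def scaleR_sum_right sum_distrib_right sum_distrib_left)
qed

text \<open>
  The real inner product for which a closed convex set has separating hyperplanes is a trace form,
  and therefore invariant under unitary conjugation.
\<close>
lemma inner_eq_Re_trace:
  fixes A B :: "complex^'n^'n"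
  shows "A \<bullet> B = Re (trace (A ** cadjoint B))"
  by (simp add: inner_vec_def trace_def matrix_matrix_mult_def cadjoint_def inner_complex_def)

lemma inner_cadjoint:
  fixes A B :: "complex^'n^'n"
  shows "cadjoint A \<bullet> cadjoint B = A \<bullet> B"
proof -
  have "(\<Sum>i\<in>UNIV. \<Sum>j\<in>UNIV. A $ j $ i \<bullet> B $ j $ i) = (\<Sum>j\<in>UNIV. \<Sum>i\<in>UNIV. A $ j $ i \<bullet> B $ j $ i)"
    by (rule sum.swap)
  then show ?thesis
    by (simp add: inner_vec_def cadjoint_def inner_complex_def)
qed

lemma trace_unitary_conj:
  assumes "unitary_matrix U"
  shows "trace (U ** A ** cadjoint U) = trace A"
proof -
  have "trace (U ** A ** cadjoint U) = trace (cadjoint U ** U ** A)"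
    by (metis matrix_mul_assoc trace_mul_sym)
  then show ?thesis
    using assms by (simp add: unitary_matrix_def)
qed

lemma inner_unitary_conj:
  fixes A B :: "complex^'n^'n"
  assumes "unitary_matrix U"
  shows "(U ** A ** cadjoint U) \<bullet> (U ** B ** cadjoint U) = A \<bullet> B"
proof -
  have "(U ** A ** cadjoint U) ** cadjoint (U ** B ** cadjoint U)
      = U ** A ** (cadjoint U ** U) ** cadjoint B ** cadjoint U"
    by (simp add: cadjoint_mult matrix_mul_assoc)
  also have "\<dots> = U ** (A ** cadjoint B) ** cadjoint U"
    using assms by (simp add: unitary_matrix_def matrix_mul_assoc)
  finally show ?thesis
    by (simp add: inner_eq_Re_trace trace_unitary_conj[OF assms])
qed

lemma compact_unitary: "compact {U :: complex^'n^'n. unitary_matrix U}"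
proof (rule compact_eq_bounded_closed[THEN iffD2], intro conjI)
  have "norm U \<le> sqrt (real CARD('n))" if "unitary_matrix U" for U :: "complex^'n^'n"
  proof -
    have "U \<bullet> U = real CARD('n)"
      using that by (simp add: inner_eq_Re_trace unitary_matrix_def trace_I)
    then show ?thesis
      by (simp add: norm_eq_sqrt_inner)
  qed
  then show "bounded {U :: complex^'n^'n. unitary_matrix U}"
    by (auto simp: bounded_iff)
  show "closed {U :: complex^'n^'n. unitary_matrix U}"
    unfolding unitary_matrix_iff vec_eq_iff matrix_matrix_mult_def cadjoint_def
    by (intro closed_Collect_all closed_Collect_eq) (auto intro!: continuous_intros)
qed

lemma continuous_on_unitary_conj:
  "continuous_on S (\<lambda>U :: complex^'n^'n. U ** A ** cadjoint U)"
  unfolding matrix_matrix_mult_def cadjoint_def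
  by (intro continuous_on_vec_lambda) (auto intro!: continuous_intros)

lemma quadratic_form_conj:
  fixes A :: "complex^'n^'n" and V :: "complex^'n^'m"
  shows "(\<Sum>i\<in>UNIV. cnj (x $ i) * ((V ** A ** cadjoint V) *v x) $ i)
       = (\<Sum>i\<in>UNIV. cnj ((cadjoint V *v x) $ i) * (A *v (cadjoint V *v x)) $ i)"
proof -
  have "(\<Sum>i\<in>UNIV. cnj (x $ i) * (V *v y) $ i) = (\<Sum>i\<in>UNIV. cnj ((cadjoint V *v x) $ i) * y $ i)"
    for y
  proof -
    have "(\<Sum>i\<in>UNIV. cnj (x $ i) * (V *v y) $ i) = (\<Sum>i\<in>UNIV. \<Sum>k\<in>UNIV. cnj (x $ i) * (V $ i $ k * y $ k))"
      by (simp add: matrix_vector_mult_def sum_distrib_left)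
    also have "\<dots> = (\<Sum>k\<in>UNIV. \<Sum>i\<in>UNIV. cnj (x $ i) * (V $ i $ k * y $ k))"
      by (rule sum.swap)
    also have "\<dots> = (\<Sum>i\<in>UNIV. cnj ((cadjoint V *v x) $ i) * y $ i)"
      by (simp add: matrix_vector_mult_def cadjoint_def sum_distrib_left mult_ac)
    finally show ?thesis .
  qed
  then show ?thesis
    by (simp flip: matrix_vector_mul_assoc)
qed

lemma psd_conj:
  assumes "psd A" shows "psd (V ** A ** cadjoint V)"
proof -
  have "cadjoint (V ** A ** cadjoint V) = V ** A ** cadjoint V"
    using assms by (simp add: psd_def cadjoint_mult matrix_mul_assoc)
  then show ?thesis
    using assms unfolding psd_def quadratic_form_conj by blast
qed

lemma psd_scaleR: "psd A \<Longrightarrow> 0 \<le> r \<Longrightarrow> psd (r *\<^sub>R A)"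
  by (simp add: psd_def cadjoint_scaleR matrix_vector_mult_def flip: scaleR_sum_right)

lemma psd_add: "psd A \<Longrightarrow> psd B \<Longrightarrow> psd (A + B)"
  by (simp add: psd_def cadjoint_add matrix_vector_mult_add_rdistrib distrib_left sum.distrib)

lemma psd_diagonal_nonneg:
  assumes "psd A"
  shows "0 \<le> Re (A $ i $ i)"
proof -
  have "0 \<le> Re (\<Sum>k\<in>UNIV. cnj (axis i 1 $ k) * (A *v axis i 1) $ k)"
    using assms unfolding psd_def by blast
  also have "(\<Sum>k\<in>UNIV. cnj (axis i 1 $ k) * (A *v axis i 1) $ k) = A $ i $ i"
    by (simp add: matrix_vector_mult_def axis_def if_distrib if_distribR cong: if_cong)
  finally show ?thesis .
qed

definition real_diag :: "('n \<Rightarrow> real) \<Rightarrow> complex^'n^'n" where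
  "real_diag a = (\<chi> i j. if i = j then complex_of_real (a i) else 0)"

lemma psd_real_diag:
  assumes "\<And>i. 0 \<le> a i"
  shows "psd (real_diag a)"
proof -
  have 1: "cadjoint (real_diag a) = real_diag a"
    by (auto simp: real_diag_def cadjoint_def vec_eq_iff)
  have "real_diag a *v x = (\<chi> i. of_real (a i) * x $ i)" for x
    by (simp add: real_diag_def matrix_vector_mult_def vec_eq_iff if_distrib if_distribR cong: if_cong)
  then have "Re (\<Sum>i\<in>UNIV. cnj (x $ i) * (real_diag a *v x) $ i) = (\<Sum>i\<in>UNIV. a i * (cmod (x $ i))\<^sup>2)" for x
    by (simp add: cmod_power2) (simp add: power2_eq_square algebra_simps)
  with 1 assms show ?thesis
    by (simp add: psd_def sum_nonneg)
qed

lemma inner_real_diag: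
  fixes X :: "complex^'n^'n"
  shows "real_diag a \<bullet> X = (\<Sum>i\<in>UNIV. a i * Re (X $ i $ i))"
proof -
  have "real_diag a $ i $ j \<bullet> X $ i $ j = (if j = i then a i * Re (X $ i $ i) else 0)" for i j
    by (simp add: real_diag_def inner_complex_def)
  then show ?thesis
    by (simp add: inner_vec_def)
qed

section \<open>Diagonalisation with eigenvalues in a prescribed order\<close>

text \<open>
  The rows of \<open>U\<close> take the role of the basis vectors, so the argument that is conjugated is the
  second one.  For \<open>A = mat 1\<close> this is the usual Hermitian inner product.
\<close>
definition row_form :: "complex^'n^'n \<Rightarrow> complex^'n \<Rightarrow> complex^'n \<Rightarrow> complex" where
  "row_form A x y = (\<Sum>k\<in>UNIV. \<Sum>l\<in>UNIV. x $ k * A $ k $ l * cnj (y $ l))"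

lemma conj_entry: "(U ** A ** cadjoint U) $ i $ j = row_form A (U $ i) (U $ j)"
proof -
  have "(U ** A ** cadjoint U) $ i $ j = (\<Sum>l\<in>UNIV. \<Sum>k\<in>UNIV. U $ i $ k * A $ k $ l * cnj (U $ j $ l))"
    by (simp add: matrix_matrix_mult_def cadjoint_def sum_distrib_right)
  then show ?thesis
    unfolding row_form_def by (subst sum.swap)
qed

lemma row_form_add_left: "row_form A (x + y) z = row_form A x z + row_form A y z"
  by (simp add: row_form_def algebra_simps sum.distrib)

lemma row_form_add_right: "row_form A x (y + z) = row_form A x y + row_form A x z"
  by (simp add: row_form_def algebra_simps sum.distrib)

lemma row_form_scale_left: "row_form A (c *s x) y = c * row_form A x y"
  by (simp add: row_form_def sum_distrib_left mult_ac)

lemma row_form_scale_right: "row_form A x (c *s y) = cnj c * row_form A x y"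
  by (simp add: row_form_def sum_distrib_left mult_ac)

lemma row_form_diff_left: "row_form A (x - y) z = row_form A x z - row_form A y z"
  by (simp add: row_form_def algebra_simps sum_subtractf)

lemma row_form_diff_right: "row_form A x (y - z) = row_form A x y - row_form A x z"
  by (simp add: row_form_def algebra_simps sum_subtractf)

lemmas row_form_sesquilinear =
  row_form_add_left row_form_add_right row_form_diff_left row_form_diff_right
  row_form_scale_left row_form_scale_right

lemma row_form_commute:
  assumes "cadjoint A = A"
  shows "row_form A y x = cnj (row_form A x y)"
proof -
  have A: "cnj (A $ k $ l) = A $ l $ k" for k l
    using assms by (metis (no_types, lifting) cadjoint_def vec_lambda_beta)
  have "cnj (row_form A x y) = (\<Sum>k\<in>UNIV. \<Sum>l\<in>UNIV. y $ l * A $ l $ k * cnj (x $ k))"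
    by (simp add: row_form_def A mult_ac)
  also have "\<dots> = row_form A y x"
    unfolding row_form_def by (rule sum.swap)
  finally show ?thesis by simp
qed

lemma unitary_iff_rows:
  "unitary_matrix U \<longleftrightarrow> (\<forall>i j. row_form (mat 1) (U $ i) (U $ j) = (if i = j then 1 else 0))"
proof -
  have "U ** cadjoint U = U ** mat 1 ** cadjoint U"
    by simp
  then show ?thesis
    unfolding unitary_matrix_iff by (simp only: vec_eq_iff conj_entry) (simp add: mat_def)
qed

text \<open>
  A Givens rotation: the rows \<open>i\<close> and \<open>j\<close> are replaced by another orthonormal basis of their span
  when \<open>\<bar>p\<bar>\<^sup>2 + \<bar>q\<bar>\<^sup>2 = 1\<close>.
\<close>
definition rotate_rows ::
    "'n \<Rightarrow> 'n \<Rightarrow> complex \<Rightarrow> complex \<Rightarrow> complex^'n^'n \<Rightarrow> complex^'n^'n" where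
  "rotate_rows i j p q U = (\<chi> k.
     if k = i then p *s U $ i + q *s U $ j
     else if k = j then cnj p *s U $ j - cnj q *s U $ i else U $ k)"

lemma unitary_rotate_rows:
  assumes U: "unitary_matrix U" and "i \<noteq> j" and pq: "p * cnj p + q * cnj q = 1"
  shows "unitary_matrix (rotate_rows i j p q U)"
proof -
  have U': "row_form (mat 1) (U $ k) (U $ l) = (if k = l then 1 else 0)" for k l
    using U by (simp add: unitary_iff_rows)
  have pq': "cnj p * p + cnj q * q = 1" "cnj q * q + cnj p * p = 1"
    using pq by (simp_all add: mult.commute add.commute)
  show ?thesis
    unfolding unitary_iff_rows
    using \<open>i \<noteq> j\<close> pq pq'
    by (auto simp: rotate_rows_def row_form_sesquilinear U')
qed

text \<open>
  Choose \<open>U\<close> to maximise the weighted diagonal sum of \<open>U ** A ** cadjoint U\<close> with weights \<open>c\<close>.  A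
  Givens rotation of two rows keeps the sum of the two diagonal entries, so at the maximum it
  cannot increase the one of larger weight.  The interchange of the two rows shows that the
  diagonal is ordered like \<open>c\<close>, and a small rotation with a suitable phase, which would gain to
  first order in its angle, shows that the off-diagonal entry is zero.
\<close>
lemma spectral_theorem_sorted:
  fixes A :: "complex^'n^'n" and c :: "'n \<Rightarrow> real"
  assumes herm: "cadjoint A = A" and c: "inj c"
  obtains U a where "unitary_matrix U" "U ** A ** cadjoint U = real_diag a"
    "\<And>i j. c i \<le> c j \<Longrightarrow> a i \<le> a j"
proof -
  define f where "f U = (\<Sum>k\<in>UNIV. c k * Re ((U ** A ** cadjoint U) $ k $ k))" for U
  have "continuous_on {U. unitary_matrix U} f"
    unfolding f_def by (intro continuous_intros continuous_on_unitary_conj)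
  moreover have "mat 1 \<in> {U :: complex^'n^'n. unitary_matrix U}"
    by (simp add: unitary_matrix_def)
  ultimately obtain U where U: "unitary_matrix U" and max: "\<And>V. unitary_matrix V \<Longrightarrow> f V \<le> f U"
    using continuous_attains_sup[OF compact_unitary] by (metis empty_iff mem_Collect_eq)
  define B where "B = U ** A ** cadjoint U"
  have B: "row_form A (U $ i) (U $ j) = B $ i $ j" for i j
    by (simp add: B_def conj_entry)
  have B_herm: "B $ j $ i = cnj (B $ i $ j)" for i j
    using row_form_commute[OF herm] by (metis B)
  have rotation: "Re (p * cnj p * B $ i $ i + q * cnj q * B $ j $ j + 2 * (p * cnj q * B $ i $ j))
      \<le> Re (B $ i $ i)"
    if "c j < c i" and pq: "p * cnj p + q * cnj q = 1" for i j p q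
  proof -
    have "i \<noteq> j" using that by auto
    let ?V = "rotate_rows i j p q U"
    define B' where "B' = ?V ** A ** cadjoint ?V"
    have B': "B' $ k $ k = row_form A (?V $ k) (?V $ k)" for k
      by (simp add: B'_def conj_entry)
    have "Re (B' $ i $ i) = Re (p * cnj p * B $ i $ i + p * cnj q * B $ i $ j
        + cnj (p * cnj q * B $ i $ j) + q * cnj q * B $ j $ j)"
      using B_herm[of i j]
      by (simp add: B' rotate_rows_def row_form_sesquilinear B algebra_simps)
    then have ii: "Re (B' $ i $ i)
        = Re (p * cnj p * B $ i $ i + q * cnj q * B $ j $ j + 2 * (p * cnj q * B $ i $ j))"
      by (simp add: algebra_simps)
    have "B' $ i $ i + B' $ j $ j = (p * cnj p + q * cnj q) * (B $ i $ i + B $ j $ j)"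
      using \<open>i \<noteq> j\<close> by (simp add: B' rotate_rows_def row_form_sesquilinear B algebra_simps)
    then have "Re (B' $ i $ i + B' $ j $ j) = Re (B $ i $ i + B $ j $ j)"
      using pq by simp
    then have jj: "Re (B' $ j $ j) - Re (B $ j $ j) = - (Re (B' $ i $ i) - Re (B $ i $ i))"
      by simp
    have other: "B' $ k $ k = B $ k $ k" if "k \<notin> {i, j}" for k
      using that by (simp add: B' rotate_rows_def B)
    have "f ?V - f U = (\<Sum>k\<in>UNIV. c k * (Re (B' $ k $ k) - Re (B $ k $ k)))"
      by (simp add: f_def B_def B'_def right_diff_distrib sum_subtractf)
    also have "\<dots> = (\<Sum>k\<in>{i, j}. c k * (Re (B' $ k $ k) - Re (B $ k $ k)))"
      by (rule sum.mono_neutral_right) (auto simp: other)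
    also have "\<dots> = (c i - c j) * (Re (B' $ i $ i) - Re (B $ i $ i))"
      using \<open>i \<noteq> j\<close> by (simp add: jj) (simp add: algebra_simps)
    finally have "(c i - c j) * (Re (B' $ i $ i) - Re (B $ i $ i)) \<le> 0"
      using max[OF unitary_rotate_rows[OF U \<open>i \<noteq> j\<close> pq]] by simp
    then show ?thesis
      using \<open>c j < c i\<close> ii by (simp add: mult_le_0_iff)
  qed
  have sorted: "Re (B $ j $ j) \<le> Re (B $ i $ i)" if "c j < c i" for i j
    using rotation[OF that, of 0 1] by simp
  have off_diag: "B $ i $ j = 0" if ij: "c j < c i" for i j
  proof (rule ccontr)
    define b where "b = cmod (B $ i $ j)"
    define d where "d = Re (B $ i $ i) - Re (B $ j $ j)"
    assume "B $ i $ j \<noteq> 0"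
    then have "0 < b" by (simp add: b_def)
    have "0 \<le> d" using sorted[OF ij] by (simp add: d_def)
    \<comment> \<open>The rotation with \<open>q / p = t * B $ i $ j / b\<close> gains \<open>2 * t * b\<close> and loses \<open>t\<^sup>2 * d\<close>, up to the
      common factor \<open>r\<^sup>2\<close> that normalises it; this \<open>t\<close> is small enough for the gain to dominate.\<close>
    define t where "t = b / (d + 1)"
    have "0 < t" using \<open>0 < b\<close> \<open>0 \<le> d\<close> by (simp add: t_def)
    define r where "r = 1 / sqrt (1 + t\<^sup>2)"
    have r: "r\<^sup>2 * (1 + t\<^sup>2) = 1"
      by (simp add: r_def power_divide add_nonneg_eq_0_iff)
    define p where "p = complex_of_real r"
    define q where "q = of_real (r * t / b) * B $ i $ j"
    have Bb: "B $ i $ j * cnj (B $ i $ j) = (of_real b)\<^sup>2"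
      unfolding b_def by (simp flip: complex_norm_square)
    have pp: "p * cnj p = of_real (r\<^sup>2)"
      by (simp add: p_def power2_eq_square)
    have "q * cnj q = (of_real (r * t / b))\<^sup>2 * (B $ i $ j * cnj (B $ i $ j))"
      by (simp add: q_def power2_eq_square)
    also have "\<dots> = of_real (r\<^sup>2 * t\<^sup>2)"
      using \<open>0 < b\<close> by (simp add: Bb power_divide power_mult_distrib)
    finally have qq: "q * cnj q = of_real (r\<^sup>2 * t\<^sup>2)" .
    have "p * cnj q * B $ i $ j = of_real (r * (r * t / b)) * (B $ i $ j * cnj (B $ i $ j))"
      by (simp add: p_def q_def)
    also have "\<dots> = of_real (r\<^sup>2 * t * b)"
      using \<open>0 < b\<close> by (simp add: Bb power2_eq_square)
    finally have pqB: "p * cnj q * B $ i $ j = of_real (r\<^sup>2 * t * b)" .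
    have "p * cnj p + q * cnj q = of_real (r\<^sup>2 * (1 + t\<^sup>2))"
      by (simp add: pp qq distrib_left)
    then have "p * cnj p + q * cnj q = 1"
      by (simp only: r of_real_1)
    from rotation[OF ij this]
    have "r\<^sup>2 * Re (B $ i $ i) + r\<^sup>2 * t\<^sup>2 * Re (B $ j $ j) + 2 * (r\<^sup>2 * t * b) \<le> Re (B $ i $ i)"
      unfolding pqB pp qq by simp
    also have "Re (B $ i $ i) = r\<^sup>2 * (1 + t\<^sup>2) * Re (B $ i $ i)"
      using r by simp
    finally have "r\<^sup>2 * t * (2 * b) \<le> r\<^sup>2 * t * (t * d)"
      by (simp add: d_def algebra_simps power2_eq_square)
    moreover have "0 < r\<^sup>2 * t"
      using \<open>0 < t\<close> r by (metis mult_eq_0_iff mult_pos_pos zero_less_power2 zero_neq_one power_zero_numeral)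
    ultimately have "2 * b \<le> t * d"
      by (simp only: mult_le_cancel_left_pos)
    also have "t * d \<le> b"
      using \<open>0 \<le> d\<close> \<open>0 < b\<close> by (simp add: t_def field_simps)
    finally show False using \<open>0 < b\<close> by simp
  qed
  have "B = real_diag (\<lambda>i. Re (B $ i $ i))"
  proof -
    have "B $ i $ i = of_real (Re (B $ i $ i))" for i
      using B_herm[of i i] by (simp add: complex_eq_iff)
    moreover have "B $ i $ j = 0" if "i \<noteq> j" for i j
    proof -
      have "c i \<noteq> c j" using c that by (auto dest: injD)
      then consider "c j < c i" | "c i < c j" by linarith
      then show ?thesis
      proof cases
        case 1
        then show ?thesis by (rule off_diag)
      next
        case 2
        then have "B $ j $ i = 0" by (rule off_diag)
        then show ?thesis using B_herm[of i j] by simp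
      qed
    qed
    ultimately show ?thesis
      by (simp add: real_diag_def vec_eq_iff)
  qed
  moreover have "Re (B $ i $ i) \<le> Re (B $ j $ j)" if "c i \<le> c j" for i j
    using that sorted injD[OF c] by (metis order_le_less)
  ultimately show ?thesis
    using that[OF U] unfolding B_def by blast
qed

section \<open>The rearrangement inequality for doubly stochastic matrices\<close>

text \<open>
  These \<open>u\<close> and \<open>v\<close> are a dual solution of the assignment problem with gains \<open>h i * z j\<close>; they
  certify that the identity assignment is optimal.  In the induction an index \<open>m\<close> is removed at
  which both \<open>h\<close> and \<open>z\<close> are maximal.  The new value \<open>s\<close> of \<open>u\<close> at \<open>m\<close> has lower bounds from the pairs
  \<open>(m, j)\<close> and, since it determines \<open>v m\<close>, upper bounds from the pairs \<open>(i, m)\<close>; they are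
  compatible because \<open>(h m - h i) * (z m - z j)\<close> is non-negative.
\<close>
lemma dual_potentials:
  fixes h z :: "'i \<Rightarrow> real"
  assumes "finite I" and "\<And>i j. i \<in> I \<Longrightarrow> j \<in> I \<Longrightarrow> 0 \<le> (h i - h j) * (z i - z j)"
  shows "\<exists>u v. (\<forall>i\<in>I. \<forall>j\<in>I. h i * z j \<le> u i + v j) \<and> (\<forall>i\<in>I. u i + v i = h i * z i)"
  using assms
proof (induction I rule: finite_psubset_induct)
  case (psubset I)
  show ?case
  proof (cases "I = {}")
    case False
    \<comment> \<open>Maximising the sum, rather than \<open>h\<close> alone, makes \<open>z\<close> maximal too when \<open>h\<close> has ties.\<close>
    let ?S = "(\<lambda>i. h i + z i) ` I"
    have "Max ?S \<in> ?S"
      using psubset.hyps False by (intro Max_in) auto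
    then obtain m where m: "m \<in> I" and m_max: "Max ?S = h m + z m"
      by blast
    have max: "h i + z i \<le> h m + z m" if "i \<in> I" for i
      unfolding m_max[symmetric] using psubset.hyps that by (intro Max_ge) auto
    have top: "h i \<le> h m \<and> z i \<le> z m" if "i \<in> I" for i
      using psubset.prems[OF that m] max[OF that] by (auto simp: zero_le_mult_iff)
    define J where "J = I - {m}"
    obtain u v where
      uv: "\<And>i j. i \<in> J \<Longrightarrow> j \<in> J \<Longrightarrow> h i * z j \<le> u i + v j"
      and uv_eq: "\<And>i. i \<in> J \<Longrightarrow> u i + v i = h i * z i"
    proof -
      have "J \<subset> I" using m by (auto simp: J_def)
      then have "\<exists>u v. (\<forall>i\<in>J. \<forall>j\<in>J. h i * z j \<le> u i + v j) \<and> (\<forall>i\<in>J. u i + v i = h i * z i)"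
        by (rule psubset.IH) (auto simp: J_def intro: psubset.prems)
      then show ?thesis using that by blast
    qed
    have cross: "h m * z j - v j \<le> h m * z m - (h i * z m - u i)" if "i \<in> J" "j \<in> J" for i j
    proof -
      have "0 \<le> (h m - h i) * (z m - z j)"
        using top that by (simp add: J_def)
      then show ?thesis
        using uv[OF that] by (simp add: algebra_simps)
    qed
    have "\<exists>s. (\<forall>j\<in>J. h m * z j - v j \<le> s) \<and> (\<forall>i\<in>J. s \<le> h m * z m - (h i * z m - u i))"
    proof (cases "J = {}")
      case False
      let ?S = "(\<lambda>j. h m * z j - v j) ` J"
      have "finite J" using psubset.hyps by (simp add: J_def)
      then show ?thesis
        using False cross by (intro exI[of _ "Max ?S"]) auto
    qed simp
    then obtain s where s1: "\<And>j. j \<in> J \<Longrightarrow> h m * z j - v j \<le> s"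
      and s2: "\<And>i. i \<in> J \<Longrightarrow> s \<le> h m * z m - (h i * z m - u i)"
      by blast
    have I: "i = m \<or> i \<in> J" if "i \<in> I" for i using that by (auto simp: J_def)
    have "m \<notin> J" by (simp add: J_def)
    let ?u = "u(m := s)" and ?v = "v(m := h m * z m - s)"
    have "h i * z j \<le> ?u i + ?v j" if "i \<in> I" "j \<in> I" for i j
      using I[OF that(1)] I[OF that(2)] uv s1 s2 by (fastforce simp: algebra_simps)
    moreover have "?u i + ?v i = h i * z i" if "i \<in> I" for i
      using I[OF that] uv_eq \<open>m \<notin> J\<close> by auto
    ultimately show ?thesis by blast
  qed simp
qed

text \<open>
  Bounding \<open>h i * z j\<close> by \<open>u i + v j\<close> makes the weighted sum depend on the row and column sums of
  \<open>D\<close> only, and the bound is an equality on the diagonal.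
\<close>
lemma doubly_stochastic_rearrangement:
  fixes D :: "'n::finite \<Rightarrow> 'n \<Rightarrow> real"
  assumes nonneg: "\<And>i j. 0 \<le> D i j"
    and rows: "\<And>i. (\<Sum>j\<in>UNIV. D i j) = 1" and cols: "\<And>j. (\<Sum>i\<in>UNIV. D i j) = 1"
    and comonotone: "\<And>i j. 0 \<le> (h i - h j) * (z i - z j)"
  shows "(\<Sum>i\<in>UNIV. \<Sum>j\<in>UNIV. D i j * (h i * z j)) \<le> (\<Sum>i\<in>UNIV. h i * z i)"
proof -
  obtain u v where uv: "\<And>i j. h i * z j \<le> u i + v j" and uv_eq: "\<And>i. u i + v i = h i * z i"
    using dual_potentials[of UNIV h z] comonotone by auto
  have "(\<Sum>i\<in>UNIV. \<Sum>j\<in>UNIV. D i j * (h i * z j)) \<le> (\<Sum>i\<in>UNIV. \<Sum>j\<in>UNIV. D i j * (u i + v j))"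
    by (intro sum_mono mult_left_mono uv nonneg)
  also have "\<dots> = (\<Sum>i\<in>UNIV. (\<Sum>j\<in>UNIV. D i j) * u i) + (\<Sum>i\<in>UNIV. \<Sum>j\<in>UNIV. D i j * v j)"
    by (simp add: distrib_left sum.distrib sum_distrib_right)
  also have "(\<Sum>i\<in>UNIV. \<Sum>j\<in>UNIV. D i j * v j) = (\<Sum>j\<in>UNIV. (\<Sum>i\<in>UNIV. D i j) * v j)"
    by (subst sum.swap) (simp add: sum_distrib_right)
  also have "(\<Sum>i\<in>UNIV. (\<Sum>j\<in>UNIV. D i j) * u i) + (\<Sum>j\<in>UNIV. (\<Sum>i\<in>UNIV. D i j) * v j)
      = (\<Sum>i\<in>UNIV. h i * z i)"
    by (simp add: rows cols uv_eq flip: sum.distrib)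
  finally show ?thesis .
qed

section \<open>Doubly stochastic maps and the unitary orbit\<close>

text \<open>
  The diagonal entries of the images of the coordinate projections \<open>e j\<close> form a matrix \<open>D\<close> that is
  doubly stochastic: positivity makes its entries non-negative, unitality gives the row sums and
  trace preservation the column sums.
\<close>
lemma inner_doubly_stochastic_map_diag:
  fixes F :: "complex^'n^'n \<Rightarrow> complex^'n^'n"
  assumes lin: "linear F" and pos: "\<And>A. psd A \<Longrightarrow> psd (F A)"
    and unital: "F (mat 1) = mat 1" and tr: "\<And>A. trace (F A) = trace A"
    and comonotone: "\<And>i j. 0 \<le> (h i - h j) * (z i - z j)"
  shows "real_diag h \<bullet> F (real_diag z) \<le> (\<Sum>i\<in>UNIV. h i * z i)"
proof -
  define e :: "'n \<Rightarrow> complex^'n^'n" where "e j = real_diag (\<lambda>k. of_bool (k = j))" for j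
  define D where "D i j = Re (F (e j) $ i $ i)" for i j
  have diag: "real_diag a = (\<Sum>j\<in>UNIV. a j *\<^sub>R e j)" for a :: "'n \<Rightarrow> real"
  proof -
    have "(a j *\<^sub>R e j) $ k $ l = (if j = k then real_diag a $ k $ l else 0)" for j k l
      by (auto simp: e_def real_diag_def complex_eq_iff)
    then have "(\<Sum>j\<in>UNIV. a j *\<^sub>R e j) $ k $ l = real_diag a $ k $ l" for k l
      by (simp only: sum_component) simp
    then show ?thesis by (simp add: vec_eq_iff)
  qed
  have F_diag: "Re (F (real_diag a) $ i $ i) = (\<Sum>j\<in>UNIV. D i j * a j)" for a i
    by (simp add: diag linear_sum[OF lin] linear_scale[OF lin] D_def mult.commute)
  have nonneg: "0 \<le> D i j" for i j
    unfolding D_def e_def by (intro psd_diagonal_nonneg pos psd_real_diag) simp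
  have one: "real_diag (\<lambda>_. 1) = (mat 1 :: complex^'n^'n)"
    by (simp add: mat_def real_diag_def vec_eq_iff)
  have rows: "(\<Sum>j\<in>UNIV. D i j) = 1" for i
    using F_diag[of "\<lambda>_. 1" i] unfolding one unital by (simp add: mat_def)
  have cols: "(\<Sum>i\<in>UNIV. D i j) = 1" for j
  proof -
    have "(\<Sum>i\<in>UNIV. D i j) = Re (trace (F (e j)))"
      by (simp add: D_def trace_def)
    also have "\<dots> = 1"
      by (simp add: tr) (simp add: e_def trace_def real_diag_def)
    finally show ?thesis .
  qed
  have "real_diag h \<bullet> F (real_diag z) = (\<Sum>i\<in>UNIV. \<Sum>j\<in>UNIV. D i j * (h i * z j))"
    by (simp add: inner_real_diag F_diag sum_distrib_left mult_ac)
  also have "\<dots> \<le> (\<Sum>i\<in>UNIV. h i * z i)"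
    by (rule doubly_stochastic_rearrangement[OF nonneg rows cols comonotone])
  finally show ?thesis .
qed

lemma positive_linear_map_linear:
  assumes "positive_linear_map E"
  shows "linear E"
proof -
  interpret E: Vector_Spaces.linear cscale_matrix cscale_matrix E
    using assms by (simp add: positive_linear_map_def)
  have real: "cscale_matrix (complex_of_real r) A = r *\<^sub>R A" for r and A :: "complex^'n^'n"
    by (simp add: cscale_matrix_def vec_eq_iff complex_eq_iff)
  show ?thesis
    by (rule linearI) (simp_all add: E.add E.scale flip: real)
qed

text \<open>
  Passing to eigenbases of \<open>H\<close> on the output side and of \<open>Z\<close> on the input side turns \<open>E\<close> into a map
  \<open>F\<close> that is again positive, unital and trace preserving, and reduces the claim to diagonal
  matrices.
\<close>
lemma inner_doubly_stochastic_map_le: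
  fixes E :: "complex^'n^'n \<Rightarrow> complex^'n^'n"
  assumes E: "positive_linear_map E" "unital_map E" "trace_preserving E"
    and H: "cadjoint H = H" and Z: "cadjoint Z = Z"
  obtains U where "unitary_matrix U" "H \<bullet> E Z \<le> H \<bullet> (U ** Z ** cadjoint U)"
proof -
  obtain c :: "'n \<Rightarrow> real" where c: "inj c"
  proof -
    obtain g :: "'n \<Rightarrow> nat" where "inj g"
      using finite_imp_inj_to_nat_seg[of "UNIV :: 'n set"] by auto
    then show ?thesis
      using that[of "\<lambda>i. real (g i)"] by (simp add: inj_def)
  qed
  \<comment> \<open>The same weights \<open>c\<close> in both diagonalisations make \<open>h\<close> and \<open>z\<close> equally ordered.\<close>
  obtain V h where V: "unitary_matrix V" and Vh: "V ** H ** cadjoint V = real_diag h"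
    and h: "\<And>i j. c i \<le> c j \<Longrightarrow> h i \<le> h j"
    using spectral_theorem_sorted[OF H c] by blast
  obtain Q z where Q: "unitary_matrix Q" and Qz: "Q ** Z ** cadjoint Q = real_diag z"
    and z: "\<And>i j. c i \<le> c j \<Longrightarrow> z i \<le> z j"
    using spectral_theorem_sorted[OF Z c] by blast
  have comonotone: "0 \<le> (h i - h j) * (z i - z j)" for i j
    using h[of i j] h[of j i] z[of i j] z[of j i] by (cases "c i \<le> c j") (auto simp: zero_le_mult_iff)
  define F where "F X = V ** E (cadjoint Q ** X ** Q) ** cadjoint V" for X
  have F_lin: "linear F"
    using linear_compose[OF linear_compose[OF linear_conj positive_linear_map_linear[OF E(1)]] linear_conj]
    unfolding F_def o_def .
  have F_pos: "psd (F A)" if "psd A" for A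
    unfolding F_def using E(1) psd_conj[OF that, of "cadjoint Q"]
    by (auto simp: positive_linear_map_def intro: psd_conj)
  have F_unital: "F (mat 1) = mat 1"
    using E(2) V Q by (simp add: F_def unital_map_def unitary_matrix_def)
  have F_trace: "trace (F A) = trace A" for A
    using E(3) trace_unitary_conj[OF V] trace_unitary_conj[OF unitary_matrix_cadjoint[OF Q], of A]
    by (simp add: F_def trace_preserving_def)
  have le: "real_diag h \<bullet> F (real_diag z) \<le> (\<Sum>i\<in>UNIV. h i * z i)"
    by (rule inner_doubly_stochastic_map_diag[OF F_lin F_pos F_unital F_trace comonotone])
  have Fz: "F (real_diag z) = V ** E Z ** cadjoint V"
    unfolding F_def by (simp only: Qz[symmetric] unitary_conj_cancel[OF Q])
  \<comment> \<open>This unitary sends the eigenbasis of \<open>Z\<close> to that of \<open>H\<close>.\<close>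
  let ?U = "cadjoint V ** Q"
  have "V ** (?U ** Z ** cadjoint ?U) ** cadjoint V
      = (V ** cadjoint V) ** (Q ** Z ** cadjoint Q) ** (V ** cadjoint V)"
    by (simp add: cadjoint_mult matrix_mul_assoc)
  also have "\<dots> = real_diag z"
    using V by (simp add: unitary_matrix_def Qz)
  finally have Uz: "V ** (?U ** Z ** cadjoint ?U) ** cadjoint V = real_diag z" .
  have "H \<bullet> E Z = real_diag h \<bullet> F (real_diag z)"
    unfolding Fz by (simp only: Vh[symmetric] inner_unitary_conj[OF V])
  also have "\<dots> \<le> real_diag h \<bullet> real_diag z"
    using le by (simp add: inner_real_diag[of h "real_diag z"]) (simp add: real_diag_def)
  also have "\<dots> = H \<bullet> (?U ** Z ** cadjoint ?U)"
    by (simp only: Vh[symmetric] Uz[symmetric] inner_unitary_conj[OF V])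
  finally show ?thesis
    using that unitary_matrix_mult[OF unitary_matrix_cadjoint[OF V] Q] by blast
qed

text \<open>
  Otherwise a hyperplane with Hermitian normal \<open>H\<close> strictly separates \<open>E Z\<close> from the whole orbit,
  while some point of the orbit is at least as far in the direction \<open>H\<close> as \<open>E Z\<close>.
\<close>
theorem doubly_stochastic_map_in_hull_orbit:
  fixes E :: "complex^'n^'n \<Rightarrow> complex^'n^'n"
  assumes E: "positive_linear_map E" "unital_map E" "trace_preserving E" and Z: "psd Z"
  shows "E Z \<in> convex hull ((\<lambda>U. U ** Z ** cadjoint U) ` {U. unitary_matrix U})"
    (is "_ \<in> convex hull ?O")
proof (rule ccontr)
  assume "E Z \<notin> convex hull ?O"
  moreover have "closed (convex hull ?O)"
    by (intro compact_imp_closed compact_convex_hull compact_continuous_image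
        continuous_on_unitary_conj compact_unitary)
  ultimately obtain a b where ab: "a \<bullet> E Z < b" "\<And>X. X \<in> convex hull ?O \<Longrightarrow> b < a \<bullet> X"
    using separating_hyperplane_closed_point[OF convex_convex_hull] by blast
  \<comment> \<open>Only the Hermitian part of \<open>a\<close> acts on Hermitian matrices; the sign turns the separation
    into an upper bound.\<close>
  define H where "H = - (a + cadjoint a)"
  have H: "cadjoint H = H"
    by (simp only: H_def cadjoint_minus cadjoint_add cadjoint_cadjoint add.commute)
  have inner: "H \<bullet> X = - 2 * (a \<bullet> X)" if "psd X" for X
    using inner_cadjoint[of a X] that by (simp add: H_def psd_def inner_diff_left)
  have herm: "cadjoint Z = Z"
    using Z by (simp add: psd_def)
  obtain U where U: "unitary_matrix U" "H \<bullet> E Z \<le> H \<bullet> (U ** Z ** cadjoint U)"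
    using inner_doubly_stochastic_map_le[OF E H herm] .
  have "psd (E Z)"
    using E(1) Z by (simp add: positive_linear_map_def)
  then have "a \<bullet> (U ** Z ** cadjoint U) \<le> a \<bullet> E Z"
    using U(2) inner[OF psd_conj[OF Z, of U]] inner[of "E Z"] by simp
  moreover have "U ** Z ** cadjoint U \<in> convex hull ?O"
    using U(1) by (intro hull_inc) auto
  ultimately show False
    using ab by fastforce
qed

section \<open>Anti-norms on the convex hull of an orbit\<close>

text \<open>
  An anti-norm is concave on the positive semidefinite cone, so its superlevel set there is convex;
  this set contains the orbit, hence also the hull.
\<close>
lemma anti_norm_ge_on_hull_orbit:
  assumes N: "symmetric_anti_norm N" and Z: "psd Z"
    and X: "X \<in> convex hull ((\<lambda>U. U ** Z ** cadjoint U) ` {U. unitary_matrix U})"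
  shows "N Z \<le> N X"
proof -
  have superadditive: "N A + N B \<le> N (A + B)" if "psd A" "psd B" for A B
    using N that by (simp add: symmetric_anti_norm_def)
  have "convex {X. psd X \<and> N Z \<le> N X}"
  proof (rule convexI, clarsimp)
    fix A B and s t :: real
    assume A: "psd A" "N Z \<le> N A" and B: "psd B" "N Z \<le> N B"
      and st: "0 \<le> s" "0 \<le> t" "s + t = 1"
    have "N Z = s * N Z + t * N Z"
      using st(3) by (metis distrib_right mult_1)
    also have "\<dots> \<le> s * N A + t * N B"
      using A(2) B(2) st by (intro add_mono mult_left_mono)
    also have "\<dots> = N (s *\<^sub>R A) + N (t *\<^sub>R B)"
      using N A(1) B(1) st by (simp add: symmetric_anti_norm_def)
    also have "\<dots> \<le> N (s *\<^sub>R A + t *\<^sub>R B)"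
      using A(1) B(1) st by (intro superadditive psd_scaleR)
    finally show "psd (s *\<^sub>R A + t *\<^sub>R B) \<and> N Z \<le> N (s *\<^sub>R A + t *\<^sub>R B)"
      using A(1) B(1) st by (simp add: psd_add psd_scaleR)
  qed
  moreover have "(\<lambda>U. U ** Z ** cadjoint U) ` {U. unitary_matrix U} \<subseteq> {X. psd X \<and> N Z \<le> N X}"
    using N Z by (auto simp: symmetric_anti_norm_def intro: psd_conj)
  ultimately have "convex hull ((\<lambda>U. U ** Z ** cadjoint U) ` {U. unitary_matrix U})
      \<subseteq> {X. psd X \<and> N Z \<le> N X}"
    by (intro hull_minimal)
  then show ?thesis
    using X by blast
qed

theorem corollary6p4:
  fixes E :: "complex^'n^'n \<Rightarrow> complex^'n^'n"
  assumes "positive_linear_map E"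
    and "unital_map E"
    and "trace_preserving E"
  shows "\<forall>Z N. psd Z \<longrightarrow> symmetric_anti_norm N \<longrightarrow> N (E Z) \<ge> N Z"
  by (intro allI impI anti_norm_ge_on_hull_orbit doubly_stochastic_map_in_hull_orbit assms)

end
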